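(* Let $(\overline{\mathcal{HV}},\varphi)$ be the centerless twisted Heisenberg-Virasoro algebra and let $(\overline{\mathcal{HV}}{}^{\circ},\Delta)$ be its dual Lie coalgebra, where $\overline{\mathcal{HV}}{}^{\circ}$ is the maximal good subspace of $\overline{\mathcal{HV}}{}^*$ and $\Delta=\varphi^*|_{\overline{\mathcal{HV}}{}^{\circ}}$. Then the cobracket $\Delta$ is uniquely determined by the following formulas, for $m\in\mathbb Z$: (1) $\displaystyle \Delta\big((\varepsilon^m,0)\big)=\sum_{i,j\in\mathbb Z,\ i+j=m+1}(j-i)\,(\varepsilon^i,0)\otimes(\varepsilon^j,0)$; (2) $\displaystyle \Delta\big((0,\varepsilon^m)\big)=\sum_{i,j\in\mathbb Z,\ i+j=m+1}\Big(j\,(\varepsilon^i,0)\otimes(0,\varepsilon^j)-i\,(0,\varepsilon^i)\otimes(\varepsilon^j,0)\Big)$.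
   Context: $\mathcal K$ is an algebraically closed field of characteristic zero, $\mathcal A=\mathcal K[x^{\pm1}]$, $\partial=\frac{d}{dx}$. $\overline{\mathcal{HV}}=\mathcal A\oplus\mathcal A$ with Lie bracket $\varphi=[\cdot,\cdot]$, $[(f_1,f_2),(g_1,g_2)]=(f_1\partial g_1-g_1\partial f_1,\ f_1\partial g_2-g_1\partial f_2)$; with $L_m=(x^{m+1},0)$, $I_n=(0,x^n)$ this reads $[L_m,L_n]=(n-m)L_{m+n}$, $[I_m,I_n]=0$, $[L_m,I_n]=nI_{m+n}$. $\varphi^*:\overline{\mathcal{HV}}{}^*\to(\overline{\mathcal{HV}}\otimes\overline{\mathcal{HV}})^*$ is the dual of the bracket; a subspace $U\subset\overline{\mathcal{HV}}{}^*$ is good if $\varphi^*(U)\subset U\otimes U$; the maximal good subspace $\overline{\mathcal{HV}}{}^{\circ}$ is the sum of all good subspaces. Explicitly $\overline{\mathcal{HV}}{}^{\circ}=\mathcal A^\circ\oplus\mathcal A^\circ$, where $\mathcal A^\circ=\{\sum_{i\in\mathbb Z}f_i\varepsilon^i\in\mathcal A^*\mid \exists\, r\in\mathbb N,\ c_1,\dots,c_r\in\mathcal K:\ f_n=\sum_{j=1}^r c_jf_{n-j}\ \forall n\in\mathbb Z\}$. $\{\varepsilon^i\}_{i\in\mathbb Z}$ is the dual system in $\mathcal A^*$ with $\varepsilon^i(x^j)=\delta_{i,j}$; every $f\in\mathcal A^*$ is written as a formal (possibly infinite) sum $f=\sum_{j\in\mathbb Z}f_j\varepsilon^j$ with $f_j=f(x^j)$.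 Pairings: $(\varepsilon^i,0)(x^k,x^l)=\delta_{i,k}$, $(0,\varepsilon^i)(x^k,x^l)=\delta_{i,l}$. Infinite sums of (tensors of) such elements denote functionals on $\overline{\mathcal{HV}}$ (resp. $\overline{\mathcal{HV}}\otimes\overline{\mathcal{HV}}$), evaluated termwise; the formulas for $\Delta$ on $(\varepsilon^m,0)$, $(0,\varepsilon^m)$ are formulas for $\varphi^*$ on these functionals, and $\Delta$ on $\overline{\mathcal{HV}}{}^\circ$ is obtained by extending them to formal infinite linear combinations. *)

theory Defs
  imports
    "HOL-Library.Poly_Mapping"
    "HOL-Library.Product_Plus"
    "HOL-Library.Function_Algebras"
    "HOL-Library.FuncSet"
    "HOL-Computational_Algebra.Polynomial"
begin

section \<open>Vector space structures\<close>

definition pm_scale :: "'k::field \<Rightarrow> ('i \<Rightarrow>\<^sub>0 'k) \<Rightarrow> ('i \<Rightarrow>\<^sub>0 'k)"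
  where "pm_scale c = Poly_Mapping.map ((*) c)"

definition fun_scale :: "'k::field \<Rightarrow> ('v \<Rightarrow> 'k) \<Rightarrow> ('v \<Rightarrow> 'k)"
  where "fun_scale c u = (\<lambda>v. c * u v)"

lemma lookup_pm_scale [simp]: "Poly_Mapping.lookup (pm_scale c p) i = c * Poly_Mapping.lookup p i"
  unfolding pm_scale_def by transfer (auto simp: when_def)

lemma vector_space_pm_scale: "vector_space (pm_scale :: 'k::field \<Rightarrow> ('i \<Rightarrow>\<^sub>0 'k) \<Rightarrow> _)"
  by unfold_locales (auto intro!: poly_mapping_eqI simp: lookup_add algebra_simps)

lemma vector_space_fun_scale: "vector_space (fun_scale :: 'k::field \<Rightarrow> ('v \<Rightarrow> 'k) \<Rightarrow> _)"
  by unfold_locales (auto simp: fun_scale_def fun_eq_iff algebra_simps)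

lemma vector_space_mult: "vector_space ((*) :: 'k::field \<Rightarrow> _)"
  by unfold_locales (auto simp: algebra_simps)


section \<open>The centerless twisted Heisenberg-Virasoro algebra\<close>

text \<open>Finitely supported functions \<open>int \<Rightarrow>\<^sub>0 'k\<close> with the convolution product are the Laurent
  polynomials; \<open>x\<^sup>n\<close> is \<open>Poly_Mapping.single n 1\<close>.\<close>

type_synonym 'k laurent = "int \<Rightarrow>\<^sub>0 'k"
type_synonym 'k hv = "'k laurent \<times> 'k laurent"

lift_definition laurent_deriv :: "'k::field laurent \<Rightarrow> 'k laurent"
  is "\<lambda>f n. of_int (n + 1) * f (n + 1)"
proof -
  fix f :: "int \<Rightarrow> 'k" assume "finite {n. f n \<noteq> 0}"
  then have "finite ((\<lambda>n. n - 1) ` {n. f n \<noteq> 0})" by simp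
  then show "finite {n. of_int (n + 1) * f (n + 1) \<noteq> 0}"
    by (rule rev_finite_subset) force
qed

lemma laurent_deriv_single:
  "laurent_deriv (Poly_Mapping.single n c) = Poly_Mapping.single (n - 1) (of_int n * c)"
  by (rule poly_mapping_eqI) (auto simp: laurent_deriv.rep_eq lookup_single when_def)

lemma laurent_deriv_0 [simp]: "laurent_deriv 0 = 0"
  by (rule poly_mapping_eqI) (simp add: laurent_deriv.rep_eq)

definition hv_scale :: "'k::field \<Rightarrow> 'k hv \<Rightarrow> 'k hv"
  where "hv_scale c v = (pm_scale c (fst v), pm_scale c (snd v))"

fun hv_bracket :: "'k::field hv \<Rightarrow> 'k hv \<Rightarrow> 'k hv"
  where "hv_bracket (f1, f2) (g1, g2) =
    (f1 * laurent_deriv g1 - g1 * laurent_deriv f1,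
     f1 * laurent_deriv g2 - g1 * laurent_deriv f2)"

lemma vector_space_hv_scale: "vector_space (hv_scale :: 'k::field \<Rightarrow> 'k hv \<Rightarrow> _)"
proof -
  interpret vector_space "pm_scale :: 'k \<Rightarrow> 'k laurent \<Rightarrow> _" by (rule vector_space_pm_scale)
  show ?thesis
    by unfold_locales (auto simp: hv_scale_def prod_eq_iff scale_right_distrib scale_left_distrib)
qed

lemma hv_bracket_LL:
  "hv_bracket (Poly_Mapping.single (m + 1) 1, 0) (Poly_Mapping.single (n + 1) 1, 0)
    = hv_scale (of_int (n - m)) (Poly_Mapping.single (m + n + 1) (1::'k::field), 0)"
  by (auto simp: hv_scale_def laurent_deriv_single mult_single algebra_simps
      lookup_add lookup_single lookup_minus when_def intro!: poly_mapping_eqI)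

lemma hv_bracket_LI:
  "hv_bracket (Poly_Mapping.single (m + 1) 1, 0) (0, Poly_Mapping.single n 1)
    = hv_scale (of_int n) (0, Poly_Mapping.single (m + n) (1::'k::field))"
  by (auto simp: hv_scale_def laurent_deriv_single mult_single algebra_simps
      lookup_add lookup_single lookup_minus when_def intro!: poly_mapping_eqI)

lemma hv_bracket_II: "hv_bracket (0, f) (0, g) = 0"
  by (simp add: zero_prod_def)

definition hv_bilinear :: "('k::field \<Rightarrow> 'w::ab_group_add \<Rightarrow> 'w) \<Rightarrow> ('k hv \<Rightarrow> 'k hv \<Rightarrow> 'w) \<Rightarrow> bool"
  where "hv_bilinear scale B \<longleftrightarrow>
    (\<forall>v. Vector_Spaces.linear hv_scale scale (B v)) \<and>
    (\<forall>w. Vector_Spaces.linear hv_scale scale (\<lambda>v. B v w))"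

lemma pm_scale_mult: "pm_scale c f = Poly_Mapping.single 0 c * f" for f :: "'k::field laurent"
  by (simp add: pm_scale_def mult_map_scale_conv_mult)

lemma laurent_deriv_add: "laurent_deriv (f + g) = laurent_deriv f + laurent_deriv g"
  by (rule poly_mapping_eqI) (simp add: laurent_deriv.rep_eq lookup_add algebra_simps)

lemma laurent_deriv_scale:
  "laurent_deriv (Poly_Mapping.single 0 c * f) = Poly_Mapping.single 0 c * laurent_deriv f"
  unfolding pm_scale_mult[symmetric] by (rule poly_mapping_eqI) (simp add: laurent_deriv.rep_eq)

lemma hv_linearD:
  assumes "Vector_Spaces.linear hv_scale scale F"
  shows "F (v + v') = F v + F v'" "F (hv_scale c v) = scale c (F v)"
proof -
  interpret Vector_Spaces.linear hv_scale scale F by fact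
  show "F (v + v') = F v + F v'" "F (hv_scale c v) = scale c (F v)" by (rule add, rule scale)
qed

lemma hv_linearI:
  assumes "vector_space scale"
    and "\<And>v v'. F (v + v') = F v + F v'" and "\<And>c v. F (hv_scale c v) = scale c (F v)"
  shows "Vector_Spaces.linear hv_scale scale F"
  using assms vector_space_hv_scale
  unfolding module_hom_eq_linear[symmetric] module_hom_def module_hom_axioms_def module_iff_vector_space
  by auto

lemma hv_bracket_bilinear: "hv_bilinear hv_scale (hv_bracket :: 'k::field hv \<Rightarrow> _)"
  unfolding hv_bilinear_def
  by (auto intro!: hv_linearI vector_space_hv_scale simp: laurent_deriv_add laurent_deriv_scale
      hv_scale_def pm_scale_mult plus_prod_def) (simp_all add: algebra_simps)


section \<open>The tensor square\<close>

text \<open>The free vector space on pairs modulo the bilinearity relations.\<close>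

type_synonym 'k hv_free = "('k hv \<times> 'k hv) \<Rightarrow>\<^sub>0 'k"

definition tensor_null :: "'k::field hv_free set"
  where "tensor_null = module.span pm_scale
    ({Poly_Mapping.single (v + v', w) 1 - Poly_Mapping.single (v, w) 1 - Poly_Mapping.single (v', w) 1 | v v' w. True} \<union>
     {Poly_Mapping.single (v, w + w') 1 - Poly_Mapping.single (v, w) 1 - Poly_Mapping.single (v, w') 1 | v w w'. True} \<union>
     {Poly_Mapping.single (hv_scale c v, w) 1 - pm_scale c (Poly_Mapping.single (v, w) 1) | c v w. True} \<union>
     {Poly_Mapping.single (v, hv_scale c w) 1 - pm_scale c (Poly_Mapping.single (v, w) 1) | c v w. True})"

definition tensor_rel :: "'k::field hv_free \<Rightarrow> 'k hv_free \<Rightarrow> bool"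
  where "tensor_rel p q \<longleftrightarrow> p - q \<in> tensor_null"

lemma subspace_tensor_null: "module.subspace pm_scale tensor_null"
proof -
  interpret vector_space "pm_scale :: 'a \<Rightarrow> 'a hv_free \<Rightarrow> _" by (rule vector_space_pm_scale)
  show ?thesis unfolding tensor_null_def by (rule subspace_span)
qed

lemma tensor_null_closed:
  fixes p q :: "'k::field hv_free"
  shows tensor_null_0: "(0 :: 'k hv_free) \<in> tensor_null"
    and tensor_null_add: "p \<in> tensor_null \<Longrightarrow> q \<in> tensor_null \<Longrightarrow> p + q \<in> tensor_null"
    and tensor_null_scale: "p \<in> tensor_null \<Longrightarrow> pm_scale c p \<in> tensor_null"
    and tensor_null_minus: "p \<in> tensor_null \<Longrightarrow> - p \<in> tensor_null"
proof -
  interpret vector_space "pm_scale :: 'k \<Rightarrow> 'k hv_free \<Rightarrow> _" by (rule vector_space_pm_scale)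
  note S = subspace_tensor_null
  show "(0 :: 'k hv_free) \<in> tensor_null" by (rule subspace_0[OF S])
  show "p \<in> tensor_null \<Longrightarrow> q \<in> tensor_null \<Longrightarrow> p + q \<in> tensor_null" by (rule subspace_add[OF S])
  show "p \<in> tensor_null \<Longrightarrow> pm_scale c p \<in> tensor_null" by (rule subspace_scale[OF S])
  show "p \<in> tensor_null \<Longrightarrow> - p \<in> tensor_null" by (rule subspace_neg[OF S])
qed

quotient_type (overloaded) 'k hv_tensor = "'k::field hv_free" / tensor_rel
proof (rule equivpI)
  show "reflp (tensor_rel :: 'k hv_free \<Rightarrow> _)"
    by (rule reflpI) (simp add: tensor_rel_def tensor_null_0)
  show "symp (tensor_rel :: 'k hv_free \<Rightarrow> _)"
    by (rule sympI) (auto simp: tensor_rel_def dest: tensor_null_minus)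
  show "transp (tensor_rel :: 'k hv_free \<Rightarrow> _)"
    by (rule transpI) (auto simp: tensor_rel_def dest: tensor_null_add)
qed

instantiation hv_tensor :: (field) ab_group_add
begin

lift_definition zero_hv_tensor :: "'a hv_tensor" is 0 .

lift_definition plus_hv_tensor :: "'a hv_tensor \<Rightarrow> 'a hv_tensor \<Rightarrow> 'a hv_tensor" is "(+)"
  unfolding tensor_rel_def by (drule (1) tensor_null_add) (simp add: algebra_simps)

lift_definition uminus_hv_tensor :: "'a hv_tensor \<Rightarrow> 'a hv_tensor" is uminus
  unfolding tensor_rel_def by (drule tensor_null_minus) (simp add: algebra_simps)

definition minus_hv_tensor :: "'a hv_tensor \<Rightarrow> 'a hv_tensor \<Rightarrow> 'a hv_tensor"
  where "minus_hv_tensor s t = s + - t"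

instance
proof
  fix a b c :: "'a hv_tensor"
  show "a + b + c = a + (b + c)"
    by (induction a, induction b, induction c) (simp add: plus_hv_tensor.abs_eq add.assoc)
  show "a + b = b + a"
    by (induction a, induction b) (simp add: plus_hv_tensor.abs_eq add.commute)
  show "0 + a = a"
    by (induction a) (simp add: plus_hv_tensor.abs_eq zero_hv_tensor_def)
  show "- a + a = 0"
    by (induction a) (simp add: plus_hv_tensor.abs_eq uminus_hv_tensor.abs_eq zero_hv_tensor_def)
qed (simp add: minus_hv_tensor_def)

end

lift_definition tensor_scale :: "'k::field \<Rightarrow> 'k hv_tensor \<Rightarrow> 'k hv_tensor" is pm_scale
proof -
  fix c :: 'k and p q :: "'k hv_free"
  interpret vector_space "pm_scale :: 'k \<Rightarrow> 'k hv_free \<Rightarrow> _" by (rule vector_space_pm_scale)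
  show "tensor_rel p q \<Longrightarrow> tensor_rel (pm_scale c p) (pm_scale c q)"
    unfolding tensor_rel_def using tensor_null_scale[of "p - q" c] by (simp add: scale_right_diff_distrib)
qed

definition tensor :: "'k::field hv \<Rightarrow> 'k hv \<Rightarrow> 'k hv_tensor"
  where "tensor v w = abs_hv_tensor (Poly_Mapping.single (v, w) 1)"

lemma vector_space_tensor_scale: "vector_space (tensor_scale :: 'k::field \<Rightarrow> 'k hv_tensor \<Rightarrow> _)"
proof -
  interpret vector_space "pm_scale :: 'k \<Rightarrow> 'k hv_free \<Rightarrow> _" by (rule vector_space_pm_scale)
  show ?thesis
  proof
    fix a b :: 'k and s t :: "'k hv_tensor"
    show "tensor_scale a (s + t) = tensor_scale a s + tensor_scale a t"
      by (induction s, induction t)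
        (simp add: plus_hv_tensor.abs_eq tensor_scale.abs_eq scale_right_distrib)
    show "tensor_scale (a + b) s = tensor_scale a s + tensor_scale b s"
      by (induction s) (simp add: plus_hv_tensor.abs_eq tensor_scale.abs_eq scale_left_distrib)
    show "tensor_scale a (tensor_scale b s) = tensor_scale (a * b) s"
      by (induction s) (simp add: tensor_scale.abs_eq)
    show "tensor_scale 1 s = s"
      by (induction s) (simp add: tensor_scale.abs_eq)
  qed
qed

text \<open>The linear map induced by a bilinear one. The value does not depend on the representative
  \<open>rep_hv_tensor t\<close> when \<open>B\<close> is bilinear (see \<open>tensor_lift_tensor\<close> below); otherwise
  \<open>tensor_lift\<close> has no meaning.\<close>

definition free_lift :: "('k::field \<Rightarrow> 'w::ab_group_add \<Rightarrow> 'w) \<Rightarrow> ('k hv \<Rightarrow> 'k hv \<Rightarrow> 'w) \<Rightarrow> 'k hv_free \<Rightarrow> 'w"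
  where "free_lift scale B p = (\<Sum>(v, w)\<in>Poly_Mapping.keys p. scale (Poly_Mapping.lookup p (v, w)) (B v w))"

definition tensor_lift :: "('k::field \<Rightarrow> 'w::ab_group_add \<Rightarrow> 'w) \<Rightarrow> ('k hv \<Rightarrow> 'k hv \<Rightarrow> 'w) \<Rightarrow> 'k hv_tensor \<Rightarrow> 'w"
  where "tensor_lift scale B t = free_lift scale B (rep_hv_tensor t)"

lemma free_lift_superset:
  assumes "vector_space scale" "finite S" "Poly_Mapping.keys p \<subseteq> S"
  shows "free_lift scale B p = (\<Sum>(v, w)\<in>S. scale (Poly_Mapping.lookup p (v, w)) (B v w))"
proof -
  interpret vector_space scale by fact
  show ?thesis unfolding free_lift_def
    by (rule sum.mono_neutral_left) (use assms in \<open>auto simp: in_keys_iff\<close>)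
qed

lemma free_lift_linear:
  assumes "vector_space scale"
  shows "Vector_Spaces.linear pm_scale scale (free_lift scale B)"
proof -
  interpret W: vector_space scale by fact
  interpret F: vector_space "pm_scale :: 'a \<Rightarrow> 'a hv_free \<Rightarrow> _" by (rule vector_space_pm_scale)
  show ?thesis
  proof
    fix p q :: "'a hv_free"
    let ?S = "Poly_Mapping.keys p \<union> Poly_Mapping.keys q"
    have "Poly_Mapping.keys (p + q) \<subseteq> ?S" by (rule keys_add)
    then show "free_lift scale B (p + q) = free_lift scale B p + free_lift scale B q"
      by (simp add: free_lift_superset[OF assms, of ?S] lookup_add W.scale_left_distrib
          sum.distrib[symmetric] case_prod_beta)
  next
    fix c and p :: "'a hv_free"
    have "Poly_Mapping.keys (pm_scale c p) \<subseteq> Poly_Mapping.keys p" by (auto simp: in_keys_iff)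
    then show "free_lift scale B (pm_scale c p) = scale c (free_lift scale B p)"
      by (simp add: free_lift_superset[OF assms, of "Poly_Mapping.keys p"] W.scale_sum_right
          case_prod_beta)
  qed
qed

lemma free_lift_single:
  assumes "vector_space scale"
  shows "free_lift scale B (Poly_Mapping.single (v, w) c) = scale c (B v w)"
proof -
  interpret vector_space scale by fact
  show ?thesis by (simp add: free_lift_superset[OF assms, of "{(v, w)}"])
qed

lemma free_lift_null:
  assumes "vector_space scale" "hv_bilinear scale B" "p \<in> tensor_null"
  shows "free_lift scale B p = 0"
proof -
  interpret W: vector_space scale by fact
  interpret L: Vector_Spaces.linear pm_scale scale "free_lift scale B"
    by (rule free_lift_linear[OF assms(1)])
  have 1: "B (v + v') w = B v w + B v' w" "B (hv_scale c v) w = scale c (B v w)" for c v v' w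
    using hv_linearD[of scale "\<lambda>v. B v w"] assms(2) unfolding hv_bilinear_def by blast+
  have 2: "B v (w + w') = B v w + B v w'" "B v (hv_scale c w) = scale c (B v w)" for c v w w'
    using hv_linearD[of scale "B v"] assms(2) unfolding hv_bilinear_def by blast+
  show ?thesis
    using assms(3) unfolding tensor_null_def
    by (rule L.eq_0_on_span[rotated])
      (elim UnE CollectE exE conjE; simp add: L.diff L.scale free_lift_single[OF assms(1)] 1 2)
qed

lemma tensor_lift_abs:
  assumes "vector_space scale" "hv_bilinear scale B"
  shows "tensor_lift scale B (abs_hv_tensor p) = free_lift scale B p"
proof -
  interpret L: Vector_Spaces.linear pm_scale scale "free_lift scale B"
    by (rule free_lift_linear[OF assms(1)])
  have "tensor_rel (rep_hv_tensor (abs_hv_tensor p)) p"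
    using Quotient3_hv_tensor by (rule rep_abs_rsp_left) (simp add: tensor_rel_def tensor_null_0)
  then have "free_lift scale B (rep_hv_tensor (abs_hv_tensor p) - p) = 0"
    using free_lift_null[OF assms] by (simp add: tensor_rel_def)
  then show ?thesis by (simp add: tensor_lift_def L.diff)
qed

lemma tensor_lift_tensor:
  assumes "vector_space scale" "hv_bilinear scale B"
  shows "tensor_lift scale B (tensor v w) = B v w"
proof -
  interpret vector_space scale by fact
  show ?thesis
    by (simp add: tensor_def tensor_lift_abs[OF assms] free_lift_single[OF assms(1)])
qed

lemma tensor_lift_linear:
  assumes "vector_space scale" "hv_bilinear scale B"
  shows "Vector_Spaces.linear tensor_scale scale (tensor_lift scale B)"
proof -
  interpret W: vector_space scale by fact
  interpret T: vector_space "tensor_scale :: 'a \<Rightarrow> 'a hv_tensor \<Rightarrow> _"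
    by (rule vector_space_tensor_scale)
  interpret L: Vector_Spaces.linear pm_scale scale "free_lift scale B"
    by (rule free_lift_linear[OF assms(1)])
  show ?thesis
  proof
    fix s t :: "'a hv_tensor" and c
    obtain p where s: "s = abs_hv_tensor p" using hv_tensor.abs_induct[of "\<lambda>s. \<exists>p. s = abs_hv_tensor p"] by auto
    obtain q where t: "t = abs_hv_tensor q" using hv_tensor.abs_induct[of "\<lambda>s. \<exists>p. s = abs_hv_tensor p"] by auto
    show "tensor_lift scale B (s + t) = tensor_lift scale B s + tensor_lift scale B t"
      by (simp add: s t plus_hv_tensor.abs_eq tensor_lift_abs[OF assms] L.add)
    show "tensor_lift scale B (tensor_scale c s) = scale c (tensor_lift scale B s)"
      by (simp add: s tensor_scale.abs_eq tensor_lift_abs[OF assms] L.scale)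
  qed
qed


section \<open>Duals and the maximal good subspace\<close>

definition hv_dual :: "('k::field hv \<Rightarrow> 'k) set"
  where "hv_dual = {u. Vector_Spaces.linear hv_scale (*) u}"

definition tensor_dual :: "('k::field hv_tensor \<Rightarrow> 'k) set"
  where "tensor_dual = {t. Vector_Spaces.linear tensor_scale (*) t}"

text \<open>The image of \<open>u \<otimes> w\<close> under the embedding of the tensor square of the dual into the dual of
  the tensor square.\<close>

definition dual_tensor :: "('k::field hv \<Rightarrow> 'k) \<Rightarrow> ('k hv \<Rightarrow> 'k) \<Rightarrow> 'k hv_tensor \<Rightarrow> 'k"  (infixl "\<otimes>" 75)
  where "u \<otimes> w = tensor_lift (*) (\<lambda>x y. u x * w y)"

definition tensor_square :: "('k::field hv \<Rightarrow> 'k) set \<Rightarrow> ('k hv_tensor \<Rightarrow> 'k) set"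
  where "tensor_square U = module.span fun_scale {u \<otimes> w | u w. u \<in> U \<and> w \<in> U}"

definition hv_bracket_dual :: "('k::field hv \<Rightarrow> 'k) \<Rightarrow> 'k hv_tensor \<Rightarrow> 'k"
  where "hv_bracket_dual u = u \<circ> tensor_lift hv_scale hv_bracket"

definition good :: "('k::field hv \<Rightarrow> 'k) set \<Rightarrow> bool"
  where "good U \<longleftrightarrow> module.subspace fun_scale U \<and> U \<subseteq> hv_dual \<and>
    hv_bracket_dual ` U \<subseteq> tensor_square U"

definition hv_circ :: "('k::field hv \<Rightarrow> 'k) set"
  where "hv_circ = module.span fun_scale (\<Union>{U. good U})"

definition hv_cobracket :: "('k::field hv \<Rightarrow> 'k) \<Rightarrow> 'k hv_tensor \<Rightarrow> 'k"
  where "hv_cobracket = restrict hv_bracket_dual hv_circ"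

lemma dual_tensor_bilinear:
  assumes "u \<in> hv_dual" "w \<in> hv_dual"
  shows "hv_bilinear (*) (\<lambda>x y. u x * w y)"
  using assms unfolding hv_bilinear_def hv_dual_def mem_Collect_eq
  by (intro conjI allI hv_linearI vector_space_mult)
    (simp_all add: hv_linearD[where scale = "(*)"] distrib_left distrib_right)

lemma dual_tensor_tensor:
  "u \<in> hv_dual \<Longrightarrow> w \<in> hv_dual \<Longrightarrow> (u \<otimes> w) (tensor x y) = u x * w y"
  unfolding dual_tensor_def
  by (rule tensor_lift_tensor[OF vector_space_mult dual_tensor_bilinear])

lemma hv_bracket_dual_tensor: "hv_bracket_dual u (tensor x y) = u (hv_bracket x y)"
  unfolding hv_bracket_dual_def
  by (simp add: tensor_lift_tensor[OF vector_space_hv_scale hv_bracket_bilinear])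

lemma good_hv_circ: "good (hv_circ :: ('k::field hv \<Rightarrow> 'k) set)"
proof -
  interpret V: vector_space "fun_scale :: 'k \<Rightarrow> ('k hv \<Rightarrow> 'k) \<Rightarrow> _" by (rule vector_space_fun_scale)
  interpret T: vector_space "fun_scale :: 'k \<Rightarrow> ('k hv_tensor \<Rightarrow> 'k) \<Rightarrow> _" by (rule vector_space_fun_scale)
  have sub: "V.subspace (hv_circ :: ('k hv \<Rightarrow> 'k) set)"
    unfolding hv_circ_def by (rule V.subspace_span)
  have dual: "V.subspace (hv_dual :: ('k hv \<Rightarrow> 'k) set)"
    unfolding V.subspace_def hv_dual_def mem_Collect_eq
    by (intro conjI ballI allI hv_linearI vector_space_mult)
      (simp_all add: fun_scale_def hv_linearD[where scale = "(*)"] algebra_simps)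
  have "hv_circ \<subseteq> (hv_dual :: ('k hv \<Rightarrow> 'k) set)"
    unfolding hv_circ_def by (rule V.span_minimal[OF _ dual]) (auto simp: good_def)
  moreover have "hv_bracket_dual u \<in> tensor_square hv_circ" if "u \<in> hv_circ" for u :: "'k hv \<Rightarrow> 'k"
    using that[unfolded hv_circ_def]
  proof (induction rule: V.span_induct_alt)
    case base
    have "hv_bracket_dual (0 :: 'k hv \<Rightarrow> 'k) = 0" by (auto simp: hv_bracket_dual_def fun_eq_iff)
    then show ?case unfolding tensor_square_def by (simp only: T.span_zero)
  next
    case (step c x y)
    then obtain U where U: "good U" "x \<in> U" by auto
    have "U \<subseteq> hv_circ" unfolding hv_circ_def using U by (auto intro: V.span_base)
    then have "tensor_square U \<subseteq> tensor_square hv_circ"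
      unfolding tensor_square_def by (intro T.span_mono) auto
    then have "hv_bracket_dual x \<in> tensor_square hv_circ" using U by (auto simp: good_def)
    moreover have "hv_bracket_dual (fun_scale c x + y)
        = fun_scale c (hv_bracket_dual x) + hv_bracket_dual y"
      by (auto simp: hv_bracket_dual_def fun_scale_def fun_eq_iff)
    ultimately show ?case
      using step unfolding tensor_square_def by (simp only: T.span_add T.span_scale)
  qed
  ultimately show ?thesis using sub unfolding good_def by auto
qed


section \<open>Formal infinite sums\<close>

text \<open>The family of functionals \<open>(w i)\<close>, \<open>i \<in> S\<close>, is pointwise finite and \<open>u\<close> is its sum,
  evaluated termwise.\<close>

definition has_formal_sum :: "('i \<Rightarrow> 'v \<Rightarrow> 'k::field) \<Rightarrow> 'i set \<Rightarrow> ('v \<Rightarrow> 'k) \<Rightarrow> bool"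
  where "has_formal_sum w S u \<longleftrightarrow>
    (\<forall>v. finite {i \<in> S. w i v \<noteq> 0} \<and> u v = (\<Sum>i | i \<in> S \<and> w i v \<noteq> 0. w i v))"

text \<open>Identification of the sum of two copies of the dual of the Laurent polynomials with the
  dual of \<open>'k hv\<close>.\<close>

definition dual_pair :: "('k::field laurent \<Rightarrow> 'k) \<Rightarrow> ('k laurent \<Rightarrow> 'k) \<Rightarrow> 'k hv \<Rightarrow> 'k"
  where "dual_pair f g = (\<lambda>(a, b). f a + g b)"

definition eps :: "int \<Rightarrow> 'k::field laurent \<Rightarrow> 'k"
  where "eps i a = Poly_Mapping.lookup a i"

definition eps1 :: "int \<Rightarrow> 'k::field hv \<Rightarrow> 'k"
  where "eps1 i = dual_pair (eps i) 0"

definition eps2 :: "int \<Rightarrow> 'k::field hv \<Rightarrow> 'k"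
  where "eps2 i = dual_pair 0 (eps i)"

text \<open>\<open>D\<close> commutes with formal, possibly infinite, linear combinations inside its domain \<open>W\<close>. Families
  with finitely many nonzero coefficients are included, so \<open>D\<close> is in particular linear.\<close>

definition formally_linear_on ::
    "('k::field hv \<Rightarrow> 'k) set \<Rightarrow> (('k hv \<Rightarrow> 'k) \<Rightarrow> 'k hv_tensor \<Rightarrow> 'k) \<Rightarrow> bool"
  where "formally_linear_on W D \<longleftrightarrow> D \<in> W \<rightarrow> tensor_dual \<and>
    (\<forall>(c :: int \<Rightarrow> 'k) u s. range u \<subseteq> W \<longrightarrow> s \<in> W \<longrightarrow>
      has_formal_sum (\<lambda>i. fun_scale (c i) (u i)) UNIV s \<longrightarrow>
      has_formal_sum (\<lambda>i. fun_scale (c i) (D (u i))) UNIV (D s))"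

definition cobracket_formulas :: "(('k::field hv \<Rightarrow> 'k) \<Rightarrow> 'k hv_tensor \<Rightarrow> 'k) \<Rightarrow> bool"
  where "cobracket_formulas D \<longleftrightarrow> (\<forall>m.
    has_formal_sum (\<lambda>(i, j). fun_scale (of_int (j - i)) (eps1 i \<otimes> eps1 j))
      {(i, j). i + j = m + 1} (D (eps1 m)) \<and>
    has_formal_sum (\<lambda>(i, j). fun_scale (of_int j) (eps1 i \<otimes> eps2 j)
                            - fun_scale (of_int i) (eps2 i \<otimes> eps1 j))
      {(i, j). i + j = m + 1} (D (eps2 m)))"

lemma eps_in_hv_dual: "eps1 m \<in> hv_dual" "eps2 m \<in> hv_dual"
  unfolding hv_dual_def
  by (auto intro!: hv_linearI vector_space_mult
      simp: eps1_def eps2_def dual_pair_def eps_def case_prod_beta lookup_add hv_scale_def)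

end

theory Submission
  imports Defs
begin

text \<open>The dual of the bracket is evaluation at the bracket, \<open>hv_bracket_dual u t = u (g t)\<close>, where \<open>g\<close> is
  the linear map on the tensor square induced by the bracket. It therefore commutes with every
  pointwise finite sum of functionals (\<open>has_formal_sum_compose\<close>). This gives formal linearity, and
  also the expansion of the cobracket, since a linear functional expands as
  \<open>u = (\<Sum>m. u (x\<^sup>m, 0) eps1 m + u (0, x\<^sup>m) eps2 m)\<close>
  (\<open>hv_dual_expansion\<close>).

  In the two formulas every summand is a linear functional on the tensor square, so that they need
  only be compared on tensors of basis vectors (\<open>has_formal_sum_basisI\<close>). There at most one
  index \<open>(i, j)\<close> contributes, and the formulas become the structure constants of the bracket
  \<open>[(x\<^sup>p, 0), (x\<^sup>q, 0)] = (q - p) (x\<^bsup>p+q-1\<^esup>, 0)\<close>,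
  \<open>[(x\<^sup>p, 0), (0, x\<^sup>q)] = q (0, x\<^bsup>p+q-1\<^esup>)\<close>,
  \<open>[(0, x\<^sup>p), (x\<^sup>q, 0)] = - p (0, x\<^bsup>p+q-1\<^esup>)\<close> and \<open>[(0, x\<^sup>p), (0, x\<^sup>q)] = 0\<close>.

  For uniqueness, formal linearity speaks of single families \<open>c i\<close>, \<open>u i\<close> indexed by the integers,
  whereas the expansion of \<open>u\<close> has two summands for each \<open>m\<close>; interleaving turns it into one such
  family (\<open>hv_dual_expansion_interleaved\<close>). A formally linear map is then determined at \<open>u\<close> by
  its values on the dual basis vectors, and these are fixed by the formulas because formal sums are
  unique.\<close>

section \<open>Induction over elementary vectors and tensors\<close>

lemma poly_mapping_sum_monomials:
  "(\<Sum>i\<in>Poly_Mapping.keys p. Poly_Mapping.single i (Poly_Mapping.lookup p i)) = p"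
  by (rule poly_mapping_eqI) (simp add: lookup_sum lookup_single when_def in_keys_iff)

lemma poly_mapping_add_induct [case_names zero add single]:
  fixes p :: "'i \<Rightarrow>\<^sub>0 'b::comm_monoid_add"
  assumes "P 0" "\<And>p q. P p \<Longrightarrow> P q \<Longrightarrow> P (p + q)" "\<And>n c. P (Poly_Mapping.single n c)"
  shows "P p"
proof -
  have "P (\<Sum>n\<in>F. Poly_Mapping.single n (Poly_Mapping.lookup p n))" if "finite F" for F
    using that by (induction F rule: finite_induct) (auto intro: assms)
  from this[OF finite_keys[of p]] show ?thesis
    by (simp only: poly_mapping_sum_monomials)
qed

text \<open>Every element of the algebra is a linear combination of the vectors \<open>(x\<^sup>n, 0)\<close> and \<open>(0, x\<^sup>n)\<close>;
  a property of these vectors that is preserved by sums and scalar multiples thus holds everywhere.\<close>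

lemma hv_induct [case_names add scale fst snd]:
  fixes v :: "'k::field hv"
  assumes add: "\<And>v w. P v \<Longrightarrow> P w \<Longrightarrow> P (v + w)"
    and scale: "\<And>c v. P v \<Longrightarrow> P (hv_scale c v)"
    and fst: "\<And>n. P (Poly_Mapping.single n 1, 0)"
    and snd: "\<And>n. P (0, Poly_Mapping.single n 1)"
  shows "P v"
proof -
  have monomial: "Poly_Mapping.single n c = pm_scale c (Poly_Mapping.single n 1)" for n :: int and c :: 'k
    by (rule poly_mapping_eqI) (simp add: lookup_single when_def)
  have zero: "P 0"
    using scale[OF fst[of 0], of 0] by (simp add: hv_scale_def pm_scale_mult zero_prod_def)
  have "P (a, 0)" for a
  proof (induction a rule: poly_mapping_add_induct)
    case (add p q)
    from assms(1)[OF this] show ?case by simp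
  next
    case (single n c)
    from scale[OF fst, of c n] show ?case
      by (simp add: hv_scale_def monomial[symmetric] pm_scale_mult[of _ 0])
  qed (use zero in \<open>simp add: zero_prod_def\<close>)
  moreover have "P (0, b)" for b
  proof (induction b rule: poly_mapping_add_induct)
    case (add p q)
    from assms(1)[OF this] show ?case by simp
  next
    case (single n c)
    from scale[OF snd, of c n] show ?case
      by (simp add: hv_scale_def monomial[symmetric] pm_scale_mult[of _ 0])
  qed (use zero in \<open>simp add: zero_prod_def\<close>)
  ultimately have "P ((fst v, 0) + (0, snd v))" by (intro add)
  then show ?thesis by simp
qed

lemma tensor_bilinear: "hv_bilinear tensor_scale (tensor :: 'k::field hv \<Rightarrow> _)"
proof -
  interpret vector_space "pm_scale :: 'k \<Rightarrow> 'k hv_free \<Rightarrow> _" by (rule vector_space_pm_scale)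
  show ?thesis
    unfolding hv_bilinear_def
  proof (intro conjI allI hv_linearI vector_space_tensor_scale)
    fix v v' w :: "'k hv" and c :: 'k
    show "tensor w (v + v') = tensor w v + tensor w v'"
      unfolding tensor_def plus_hv_tensor.abs_eq hv_tensor.abs_eq_iff tensor_rel_def tensor_null_def
        diff_diff_eq[symmetric]
      by (rule span_base) blast
    show "tensor (v + v') w = tensor v w + tensor v' w"
      unfolding tensor_def plus_hv_tensor.abs_eq hv_tensor.abs_eq_iff tensor_rel_def tensor_null_def
        diff_diff_eq[symmetric]
      by (rule span_base) blast
    show "tensor w (hv_scale c v) = tensor_scale c (tensor w v)"
      unfolding tensor_def tensor_scale.abs_eq hv_tensor.abs_eq_iff tensor_rel_def tensor_null_def
      by (rule span_base) blast
    show "tensor (hv_scale c v) w = tensor_scale c (tensor v w)"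
      unfolding tensor_def tensor_scale.abs_eq hv_tensor.abs_eq_iff tensor_rel_def tensor_null_def
      by (rule span_base) blast
  qed
qed

lemma tensor_induct [case_names add scale tensor]:
  fixes t :: "'k::field hv_tensor"
  assumes add: "\<And>s t. P s \<Longrightarrow> P t \<Longrightarrow> P (s + t)"
    and scale: "\<And>c t. P t \<Longrightarrow> P (tensor_scale c t)"
    and tensor: "\<And>v w. P (tensor v w)"
  shows "P t"
proof (induction t)
  fix p :: "'k hv_free"
  interpret vector_space "tensor_scale :: 'k \<Rightarrow> 'k hv_tensor \<Rightarrow> _"
    by (rule vector_space_tensor_scale)
  have monomial: "Poly_Mapping.single x c = pm_scale c (Poly_Mapping.single x 1)"
    for x :: "'k hv \<times> 'k hv" and c :: 'k
    by (rule poly_mapping_eqI) (simp add: lookup_single when_def)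
  have zero: "P (abs_hv_tensor 0)"
    using scale[OF tensor, of 0] unfolding zero_hv_tensor_def[symmetric] by simp
  show "P (abs_hv_tensor p)"
  proof (induction p rule: poly_mapping_add_induct)
    case (add p q)
    from assms(1)[OF this] show ?case by (simp add: plus_hv_tensor.abs_eq)
  next
    case (single x c)
    from scale[OF tensor[of "fst x" "snd x"], of c] show ?case
      by (simp add: tensor_def tensor_scale.abs_eq monomial[symmetric])
  qed (fact zero)
qed

lemma tensor_basis_induct [case_names add scale fst_fst fst_snd snd_fst snd_snd]:
  fixes t :: "'k::field hv_tensor"
  assumes add: "\<And>s t. P s \<Longrightarrow> P t \<Longrightarrow> P (s + t)"
    and scale: "\<And>c t. P t \<Longrightarrow> P (tensor_scale c t)"
    and basis: "\<And>p q. P (tensor (Poly_Mapping.single p 1, 0) (Poly_Mapping.single q 1, 0))"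
      "\<And>p q. P (tensor (Poly_Mapping.single p 1, 0) (0, Poly_Mapping.single q 1))"
      "\<And>p q. P (tensor (0, Poly_Mapping.single p 1) (Poly_Mapping.single q 1, 0))"
      "\<And>p q. P (tensor (0, Poly_Mapping.single p 1) (0, Poly_Mapping.single q 1))"
  shows "P t"
proof (induction t rule: tensor_induct)
  case (tensor v w)
  note lin = hv_linearD[OF tensor_bilinear[unfolded hv_bilinear_def, THEN conjunct1, rule_format]]
    hv_linearD[OF tensor_bilinear[unfolded hv_bilinear_def, THEN conjunct2, rule_format]]
  have "P (tensor (Poly_Mapping.single p 1, 0) w)" "P (tensor (0, Poly_Mapping.single p 1) w)" for p
    by (induction w rule: hv_induct) (auto simp: lin intro: assms)
  then show ?case
    by (induction v rule: hv_induct) (auto simp: lin intro: assms)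
qed (fact add scale)+


section \<open>Formal sums of functionals\<close>

lemma tensor_dualD:
  assumes "h \<in> tensor_dual"
  shows "h (s + t) = h s + h t" "h (tensor_scale c t) = c * h t"
proof -
  interpret Vector_Spaces.linear tensor_scale "(*)" h
    using assms by (simp add: tensor_dual_def)
  show "h (s + t) = h s + h t" "h (tensor_scale c t) = c * h t" by (rule add, rule scale)
qed

lemma dual_tensor_in_tensor_dual: "u \<in> hv_dual \<Longrightarrow> w \<in> hv_dual \<Longrightarrow> u \<otimes> w \<in> tensor_dual"
  unfolding tensor_dual_def dual_tensor_def
  by (simp add: tensor_lift_linear[OF vector_space_mult dual_tensor_bilinear])

lemma hv_bracket_dual_in_tensor_dual: "u \<in> hv_dual \<Longrightarrow> hv_bracket_dual u \<in> tensor_dual"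
  unfolding tensor_dual_def hv_dual_def hv_bracket_dual_def mem_Collect_eq
  by (rule Vector_Spaces.linear_compose[OF
        tensor_lift_linear[OF vector_space_hv_scale hv_bracket_bilinear]])

lemma subspace_tensor_dual: "module.subspace fun_scale (tensor_dual :: ('k::field hv_tensor \<Rightarrow> 'k) set)"
proof -
  interpret V: vector_space "fun_scale :: 'k \<Rightarrow> ('k hv_tensor \<Rightarrow> 'k) \<Rightarrow> _"
    by (rule vector_space_fun_scale)
  have linI: "Vector_Spaces.linear tensor_scale (*) h"
    if "\<And>s t. h (s + t) = h s + h t" "\<And>c t. h (tensor_scale c t) = c * h t"
    for h :: "'k hv_tensor \<Rightarrow> 'k"
    using that vector_space_tensor_scale vector_space_mult
    unfolding module_hom_eq_linear[symmetric] module_hom_def module_hom_axioms_def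
      module_iff_vector_space by auto
  show ?thesis
    unfolding V.subspace_def
    by (auto simp: tensor_dual_def fun_scale_def tensor_dualD algebra_simps intro!: linI)
qed

text \<open>A pointwise finite sum may be evaluated over any finite set containing the support.\<close>

lemma has_formal_sumI:
  assumes "\<And>v. \<exists>F. finite F \<and> F \<subseteq> S \<and> (\<forall>i\<in>S - F. w i v = 0) \<and> u v = (\<Sum>i\<in>F. w i v)"
  shows "has_formal_sum w S u"
  unfolding has_formal_sum_def
proof (intro allI)
  fix v
  obtain F where F: "finite F" "F \<subseteq> S" "\<forall>i\<in>S - F. w i v = 0" "u v = (\<Sum>i\<in>F. w i v)"
    using assms by blast
  have sub: "{i \<in> S. w i v \<noteq> 0} \<subseteq> F" using F by blast
  then have "(\<Sum>i | i \<in> S \<and> w i v \<noteq> 0. w i v) = (\<Sum>i\<in>F. w i v)"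
    by (rule sum.mono_neutral_left[OF F(1)]) (use F in auto)
  then show "finite {i \<in> S. w i v \<noteq> 0} \<and> u v = (\<Sum>i | i \<in> S \<and> w i v \<noteq> 0. w i v)"
    using F(1,4) sub by (auto intro: finite_subset)
qed

lemma has_formal_sum_unique:
  "has_formal_sum w S u \<Longrightarrow> has_formal_sum w S u' \<Longrightarrow> u = u'"
  by (auto simp: has_formal_sum_def)

lemma has_formal_sum_compose:
  "has_formal_sum w S u \<Longrightarrow> has_formal_sum (\<lambda>i x. w i (g x)) S (\<lambda>x. u (g x))"
  unfolding has_formal_sum_def by (rule allI) (drule spec)

text \<open>The tensors at which a family of functionals is finite and has the prescribed sum form a
  subspace, so that it is enough to examine tensors of basis vectors.\<close>

lemma has_formal_sum_basisI:
  fixes u :: "'k::field hv_tensor \<Rightarrow> 'k"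
  assumes w: "\<And>i. i \<in> S \<Longrightarrow> w i \<in> tensor_dual" and u: "u \<in> tensor_dual"
    and basis: "\<And>a b p q. a \<in> {(Poly_Mapping.single p 1, 0), (0, Poly_Mapping.single p 1)} \<Longrightarrow>
      b \<in> {(Poly_Mapping.single q 1, 0), (0, Poly_Mapping.single q 1)} \<Longrightarrow>
      \<exists>F. finite F \<and> F \<subseteq> S \<and> (\<forall>i\<in>S - F. w i (tensor a b) = 0) \<and>
        u (tensor a b) = (\<Sum>i\<in>F. w i (tensor a b))"
  shows "has_formal_sum w S u"
proof (rule has_formal_sumI)
  fix t
  show "\<exists>F. finite F \<and> F \<subseteq> S \<and> (\<forall>i\<in>S - F. w i t = 0) \<and> u t = (\<Sum>i\<in>F. w i t)"
  proof (induction t rule: tensor_basis_induct)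
    case (add s t)
    then obtain F G where F: "finite F" "F \<subseteq> S" "\<forall>i\<in>S - F. w i s = 0" "u s = (\<Sum>i\<in>F. w i s)"
      and G: "finite G" "G \<subseteq> S" "\<forall>i\<in>S - G. w i t = 0" "u t = (\<Sum>i\<in>G. w i t)"
      by blast
    have "u s = (\<Sum>i\<in>F \<union> G. w i s)" "u t = (\<Sum>i\<in>F \<union> G. w i t)"
      unfolding F(4) G(4) using F G by (auto intro!: sum.mono_neutral_left)
    moreover have "(\<Sum>i\<in>F \<union> G. w i (s + t)) = (\<Sum>i\<in>F \<union> G. w i s) + (\<Sum>i\<in>F \<union> G. w i t)"
      unfolding sum.distrib[symmetric]
      by (rule sum.cong[OF refl], rule tensor_dualD, rule w) (use F(2) G(2) in auto)
    ultimately have "u (s + t) = (\<Sum>i\<in>F \<union> G. w i (s + t))"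
      by (simp add: tensor_dualD[OF u])
    then show ?case
      using F G by (intro exI[of _ "F \<union> G"]) (simp add: tensor_dualD[OF w])
  next
    case (scale c t)
    then obtain F where F: "finite F" "F \<subseteq> S" "\<forall>i\<in>S - F. w i t = 0" "u t = (\<Sum>i\<in>F. w i t)"
      by blast
    have "u (tensor_scale c t) = (\<Sum>i\<in>F. w i (tensor_scale c t))"
      unfolding tensor_dualD(2)[OF u] F(4) sum_distrib_left
      by (rule sum.cong[OF refl], rule tensor_dualD(2)[symmetric], rule w) (use F(2) in auto)
    then show ?case
      using F by (intro exI[of _ F]) (simp add: tensor_dualD[OF w])
  qed (rule basis; blast)+
qed


section \<open>The cobracket formulas on basis tensors\<close>

lemma eps_apply:
  "eps1 i (a, b) = Poly_Mapping.lookup a i" "eps2 i (a, b) = Poly_Mapping.lookup b i"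
  by (simp_all add: eps1_def eps2_def dual_pair_def eps_def)

lemma cobracket_formulas_hv_bracket_dual:
  "cobracket_formulas (hv_bracket_dual :: ('k::field hv \<Rightarrow> 'k) \<Rightarrow> _)"
proof -
  interpret V: vector_space "fun_scale :: 'k \<Rightarrow> ('k hv_tensor \<Rightarrow> 'k) \<Rightarrow> _"
    by (rule vector_space_fun_scale)
  note eps = eps_in_hv_dual
  note dual = dual_tensor_in_tensor_dual[OF eps(1) eps(1)] dual_tensor_in_tensor_dual[OF eps(1) eps(2)]
    dual_tensor_in_tensor_dual[OF eps(2) eps(1)]
  note vals = hv_bracket_dual_tensor dual_tensor_tensor eps eps_apply
    laurent_deriv_single mult_single fun_scale_def lookup_minus lookup_single when_def
  show ?thesis
    unfolding cobracket_formulas_def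
  proof (intro allI conjI has_formal_sum_basisI)
    fix m :: int
    show "hv_bracket_dual (eps1 m :: 'k hv \<Rightarrow> 'k) \<in> tensor_dual"
      "hv_bracket_dual (eps2 m :: 'k hv \<Rightarrow> 'k) \<in> tensor_dual"
      by (intro hv_bracket_dual_in_tensor_dual eps)+
    fix ij :: "int \<times> int"
    show "(case ij of (i, j) \<Rightarrow> fun_scale (of_int (j - i)) (eps1 i \<otimes> eps1 j))
        \<in> (tensor_dual :: ('k hv_tensor \<Rightarrow> 'k) set)"
      by (cases ij) (simp add: V.subspace_scale[OF subspace_tensor_dual] dual del: of_int_diff)
    show "(case ij of (i, j) \<Rightarrow> fun_scale (of_int j) (eps1 i \<otimes> eps2 j)
            - fun_scale (of_int i) (eps2 i \<otimes> eps1 j))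
        \<in> (tensor_dual :: ('k hv_tensor \<Rightarrow> 'k) set)"
      by (cases ij) (simp add: V.subspace_scale[OF subspace_tensor_dual]
          V.subspace_diff[OF subspace_tensor_dual] dual)
  next
    fix m p q :: int and a b :: "'k hv"
    assume ab: "a \<in> {(Poly_Mapping.single p 1, 0), (0, Poly_Mapping.single p 1)}"
      "b \<in> {(Poly_Mapping.single q 1, 0), (0, Poly_Mapping.single q 1)}"
    \<comment> \<open>Only the index \<open>(p, q)\<close> can contribute, and it occurs only if \<open>p + q = m + 1\<close>.\<close>
    let ?S = "{(i, j). i + j = m + 1}" and ?F = "if p + q = m + 1 then {(p, q)} else {}"
    let ?w1 = "\<lambda>(i, j). fun_scale (of_int (j - i)) (eps1 i \<otimes> eps1 j) :: 'k hv_tensor \<Rightarrow> 'k"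
    let ?w2 = "\<lambda>(i, j). fun_scale (of_int j) (eps1 i \<otimes> eps2 j)
      - fun_scale (of_int i) (eps2 i \<otimes> eps1 j) :: 'k hv_tensor \<Rightarrow> 'k"
    show "\<exists>F. finite F \<and> F \<subseteq> ?S \<and> (\<forall>ij\<in>?S - F. ?w1 ij (tensor a b) = 0) \<and>
        hv_bracket_dual (eps1 m) (tensor a b) = (\<Sum>ij\<in>F. ?w1 ij (tensor a b))"
      using ab by (intro exI[of _ ?F]) (auto simp: vals algebra_simps split: if_splits)
    show "\<exists>F. finite F \<and> F \<subseteq> ?S \<and> (\<forall>ij\<in>?S - F. ?w2 ij (tensor a b) = 0) \<and>
        hv_bracket_dual (eps2 m) (tensor a b) = (\<Sum>ij\<in>F. ?w2 ij (tensor a b))"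
      using ab by (intro exI[of _ ?F]) (auto simp: vals algebra_simps split: if_splits)
  qed
qed


section \<open>Formal linearity and expansion in the dual basis\<close>

lemma formally_linear_on_hv_bracket_dual:
  "formally_linear_on hv_dual (hv_bracket_dual :: ('k::field hv \<Rightarrow> 'k) \<Rightarrow> _)"
  unfolding formally_linear_on_def
proof (intro conjI allI impI)
  show "hv_bracket_dual \<in> hv_dual \<rightarrow> (tensor_dual :: ('k hv_tensor \<Rightarrow> 'k) set)"
    by (simp add: hv_bracket_dual_in_tensor_dual)
next
  fix c :: "int \<Rightarrow> 'k" and u s
  assume "has_formal_sum (\<lambda>i. fun_scale (c i) (u i)) UNIV (s :: 'k hv \<Rightarrow> 'k)"
  then show "has_formal_sum (\<lambda>i. fun_scale (c i) (hv_bracket_dual (u i))) UNIV (hv_bracket_dual s)"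
    unfolding hv_bracket_dual_def fun_scale_def comp_def by (rule has_formal_sum_compose)
qed

lemma hv_circ_subset_hv_dual: "hv_circ \<subseteq> hv_dual"
  using good_hv_circ by (auto simp: good_def)

lemma hv_dual_expansion:
  fixes u :: "'k::field hv \<Rightarrow> 'k"
  assumes "u \<in> hv_dual"
  shows "has_formal_sum (\<lambda>m. fun_scale (u (Poly_Mapping.single m 1, 0)) (eps1 m)
    + fun_scale (u (0, Poly_Mapping.single m 1)) (eps2 m)) UNIV u"
proof (rule has_formal_sumI)
  fix v :: "'k hv"
  obtain a b where v: "v = (a, b)" by (cases v)
  let ?F = "Poly_Mapping.keys a \<union> Poly_Mapping.keys b"
  have add: "u (x + y) = u x + u y" and scale: "u (hv_scale c x) = c * u x" for x y c
    using hv_linearD[of "(*)" u] assms by (auto simp: hv_dual_def)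
  have zero: "u 0 = 0"
    using scale[of 0 0] by (simp add: hv_scale_def pm_scale_mult zero_prod_def)
  have sum: "u (\<Sum>n\<in>F. f n) = (\<Sum>n\<in>F. u (f n))" if "finite F" for F and f :: "int \<Rightarrow> 'k hv"
    using that by (induction F rule: finite_induct) (auto simp: add zero)
  have expand: "(\<Sum>n\<in>?F. pm_scale (Poly_Mapping.lookup p n) (Poly_Mapping.single n 1)) = p"
    if "Poly_Mapping.keys p \<subseteq> ?F" for p :: "'k laurent"
    using that
    by (intro poly_mapping_eqI) (auto simp: lookup_sum lookup_single when_def in_keys_iff
        if_distrib[of "(*) _"] sum.delta cong: if_cong)
  have "v = (\<Sum>n\<in>?F. hv_scale (Poly_Mapping.lookup a n) (Poly_Mapping.single n 1, 0)
      + hv_scale (Poly_Mapping.lookup b n) (0, Poly_Mapping.single n 1))"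
    using expand[of a] expand[of b]
    by (simp add: v prod_eq_iff fst_sum snd_sum hv_scale_def pm_scale_mult[of _ 0])
  then have "u v = (\<Sum>n\<in>?F. Poly_Mapping.lookup a n * u (Poly_Mapping.single n 1, 0)
      + Poly_Mapping.lookup b n * u (0, Poly_Mapping.single n 1))"
    by (simp add: sum add scale)
  then show "\<exists>F. finite F \<and> F \<subseteq> UNIV \<and>
      (\<forall>m\<in>UNIV - F. (fun_scale (u (Poly_Mapping.single m 1, 0)) (eps1 m)
        + fun_scale (u (0, Poly_Mapping.single m 1)) (eps2 m)) v = 0) \<and>
      u v = (\<Sum>m\<in>F. (fun_scale (u (Poly_Mapping.single m 1, 0)) (eps1 m)
        + fun_scale (u (0, Poly_Mapping.single m 1)) (eps2 m)) v)"
    by (intro exI[of _ ?F]) (auto simp: v fun_scale_def eps1_def eps2_def dual_pair_def eps_def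
        in_keys_iff mult.commute)
qed

text \<open>The same expansion as a single family indexed by the integers, interleaving the two families
  of dual basis vectors: the even index \<open>2 * m\<close> carries \<open>eps1 m\<close>, the odd index \<open>2 * m + 1\<close>
  carries \<open>eps2 m\<close>.\<close>

lemma hv_dual_expansion_interleaved:
  fixes u :: "'k::field hv \<Rightarrow> 'k"
  assumes "u \<in> hv_dual"
  shows "has_formal_sum (\<lambda>i. fun_scale
      (if even i then u (Poly_Mapping.single (i div 2) 1, 0) else u (0, Poly_Mapping.single (i div 2) 1))
      (if even i then eps1 (i div 2) else eps2 (i div 2))) UNIV u"
    (is "has_formal_sum ?w _ _")
proof (rule has_formal_sumI)
  fix v :: "'k hv"
  let ?w' = "\<lambda>m. fun_scale (u (Poly_Mapping.single m 1, 0)) (eps1 m)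
    + fun_scale (u (0, Poly_Mapping.single m 1)) (eps2 m) :: 'k hv \<Rightarrow> 'k"
  let ?G = "Poly_Mapping.keys (fst v) \<union> Poly_Mapping.keys (snd v)"
  let ?F = "(\<lambda>m. 2 * m) ` ?G \<union> (\<lambda>m. 2 * m + 1) ` ?G"
  have vanish: "eps1 m v = 0" "eps2 m v = 0" if "m \<notin> ?G" for m
    using that by (auto simp: eps1_def eps2_def dual_pair_def eps_def in_keys_iff case_prod_beta)
  have "u v = (\<Sum>m | m \<in> UNIV \<and> ?w' m v \<noteq> 0. ?w' m v)"
    by (rule hv_dual_expansion[OF assms, unfolded has_formal_sum_def, rule_format, THEN conjunct2])
  also have "\<dots> = (\<Sum>m\<in>?G. ?w' m v)"
  proof (rule sum.mono_neutral_left)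
    show "{m \<in> UNIV. ?w' m v \<noteq> 0} \<subseteq> ?G"
      using vanish by (force simp: fun_scale_def)
  qed simp_all
  also have "\<dots> = (\<Sum>m\<in>?G. ?w (2 * m) v) + (\<Sum>m\<in>?G. ?w (2 * m + 1) v)"
    by (simp add: sum.distrib)
  also have "\<dots> = (\<Sum>i\<in>(\<lambda>m. 2 * m) ` ?G. ?w i v) + (\<Sum>i\<in>(\<lambda>m. 2 * m + 1) ` ?G. ?w i v)"
    by (subst (1 2) sum.reindex) (simp_all add: inj_on_def o_def)
  also have "\<dots> = (\<Sum>i\<in>?F. ?w i v)"
  proof (rule sum.union_disjoint[symmetric])
    show "(\<lambda>m. 2 * m) ` ?G \<inter> (\<lambda>m. 2 * m + 1) ` ?G = {}"
      by (auto simp: disjoint_iff) presburger+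
  qed simp_all
  finally have "u v = (\<Sum>i\<in>?F. ?w i v)" .
  moreover have "?w i v = 0" if "i \<notin> ?F" for i
  proof -
    have "i = 2 * (i div 2) \<or> i = 2 * (i div 2) + 1" by presburger
    with that have "i div 2 \<notin> ?G" by blast
    then show ?thesis by (simp add: fun_scale_def vanish)
  qed
  ultimately show "\<exists>F. finite F \<and> F \<subseteq> UNIV \<and> (\<forall>i\<in>UNIV - F. ?w i v = 0) \<and> u v = (\<Sum>i\<in>F. ?w i v)"
    by (intro exI[of _ ?F]) simp
qed

lemma hv_bracket_dual_expansion:
  assumes "u \<in> hv_dual"
  shows "has_formal_sum (\<lambda>m. fun_scale (u (Poly_Mapping.single m 1, 0)) (hv_bracket_dual (eps1 m))
    + fun_scale (u (0, Poly_Mapping.single m 1)) (hv_bracket_dual (eps2 m)))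
    UNIV (hv_bracket_dual u)"
proof -
  have "hv_bracket_dual w = (\<lambda>t. w (tensor_lift hv_scale hv_bracket t))" for w :: "'a hv \<Rightarrow> 'a"
    by (simp add: hv_bracket_dual_def fun_eq_iff)
  with has_formal_sum_compose[OF hv_dual_expansion[OF assms], of "tensor_lift hv_scale hv_bracket"]
  show ?thesis
    by (simp only: plus_fun_def fun_scale_def)
qed


section \<open>Uniqueness\<close>

lemma cobracket_formulas_unique:
  assumes "cobracket_formulas D" "cobracket_formulas D'"
  shows "D (eps1 m) = D' (eps1 m)" "D (eps2 m) = D' (eps2 m)"
proof -
  note formulas = assms[unfolded cobracket_formulas_def, rule_format]
  show "D (eps1 m) = D' (eps1 m)"
    by (rule has_formal_sum_unique[OF formulas(1)[THEN conjunct1] formulas(2)[THEN conjunct1]])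
  show "D (eps2 m) = D' (eps2 m)"
    by (rule has_formal_sum_unique[OF formulas(1)[THEN conjunct2] formulas(2)[THEN conjunct2]])
qed

lemma formally_linear_onD:
  fixes c :: "int \<Rightarrow> 'k::field"
  assumes "formally_linear_on W D" "range u \<subseteq> W" "s \<in> W"
    and "has_formal_sum (\<lambda>i. fun_scale (c i) (u i)) UNIV s"
  shows "has_formal_sum (\<lambda>i. fun_scale (c i) (D (u i))) UNIV (D s)"
  using assms(1)[unfolded formally_linear_on_def, THEN conjunct2, rule_format, OF assms(2-4)] .

text \<open>Two formally linear maps, possibly with different domains, that agree on the dual basis vectors
  agree on every linear functional in both domains.\<close>

lemma formally_linear_on_unique:
  fixes D D' :: "('k::field hv \<Rightarrow> 'k) \<Rightarrow> 'k hv_tensor \<Rightarrow> 'k"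
  assumes D: "formally_linear_on W D" "formally_linear_on W' D'"
    and W: "range eps1 \<union> range eps2 \<subseteq> W \<inter> W'"
    and eps: "\<And>m. D (eps1 m) = D' (eps1 m)" "\<And>m. D (eps2 m) = D' (eps2 m)"
    and u: "u \<in> W \<inter> W' \<inter> hv_dual"
  shows "D u = D' u"
proof -
  define c where "c i = (if even i then u (Poly_Mapping.single (i div 2) 1, 0)
    else u (0, Poly_Mapping.single (i div 2) 1))" for i :: int
  define e :: "int \<Rightarrow> 'k hv \<Rightarrow> 'k" where "e i = (if even i then eps1 (i div 2) else eps2 (i div 2))" for i
  have sum: "has_formal_sum (\<lambda>i. fun_scale (c i) (e i)) UNIV u"
    unfolding c_def e_def by (rule hv_dual_expansion_interleaved) (use u in simp)
  have range: "range e \<subseteq> W" "range e \<subseteq> W'"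
    using W by (auto simp: e_def)
  have uW: "u \<in> W" "u \<in> W'" using u by simp_all
  have "has_formal_sum (\<lambda>i. fun_scale (c i) (D (e i))) UNIV (D u)"
    by (rule formally_linear_onD[OF D(1) range(1) uW(1) sum])
  moreover have "has_formal_sum (\<lambda>i. fun_scale (c i) (D (e i))) UNIV (D' u)"
  proof -
    have "D (e i) = D' (e i)" for i
      by (simp add: e_def eps)
    with formally_linear_onD[OF D(2) range(2) uW(2) sum] show ?thesis by simp
  qed
  ultimately show ?thesis by (rule has_formal_sum_unique)
qed

theorem theorem3p4:
  fixes \<Delta> :: "('k::{alg_closed_field, field_char_0} hv \<Rightarrow> 'k) \<Rightarrow> 'k hv_tensor \<Rightarrow> 'k"
  defines "\<Delta> \<equiv> hv_cobracket"
  shows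
    "cobracket_formulas (hv_bracket_dual :: ('k hv \<Rightarrow> 'k) \<Rightarrow> _) \<and>
     formally_linear_on hv_dual (hv_bracket_dual :: ('k hv \<Rightarrow> 'k) \<Rightarrow> _) \<and>
     (\<forall>u\<in>hv_circ. has_formal_sum
        (\<lambda>m. fun_scale (u (Poly_Mapping.single m 1, 0)) (hv_bracket_dual (eps1 m))
           + fun_scale (u (0, Poly_Mapping.single m 1)) (hv_bracket_dual (eps2 m)))
        UNIV (\<Delta> u)) \<and>
     (\<forall>W D. hv_circ \<union> range eps1 \<union> range eps2 \<subseteq> W \<and> W \<subseteq> hv_dual \<and>
        formally_linear_on W D \<and> cobracket_formulas D \<longrightarrow>
        (\<forall>u\<in>hv_circ. D u = \<Delta> u))"
proof (intro conjI ballI allI impI)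
  show "cobracket_formulas (hv_bracket_dual :: ('k hv \<Rightarrow> 'k) \<Rightarrow> _)"
    by (rule cobracket_formulas_hv_bracket_dual)
  show "formally_linear_on hv_dual (hv_bracket_dual :: ('k hv \<Rightarrow> 'k) \<Rightarrow> _)"
    by (rule formally_linear_on_hv_bracket_dual)
next
  fix u :: "'k hv \<Rightarrow> 'k" assume "u \<in> hv_circ"
  then show "has_formal_sum
      (\<lambda>m. fun_scale (u (Poly_Mapping.single m 1, 0)) (hv_bracket_dual (eps1 m))
         + fun_scale (u (0, Poly_Mapping.single m 1)) (hv_bracket_dual (eps2 m))) UNIV (\<Delta> u)"
    using hv_bracket_dual_expansion[OF subsetD[OF hv_circ_subset_hv_dual], of u]
    unfolding \<Delta>_def hv_cobracket_def by (simp only: restrict_apply if_True)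
next
  fix W and D :: "('k hv \<Rightarrow> 'k) \<Rightarrow> 'k hv_tensor \<Rightarrow> 'k" and u :: "'k hv \<Rightarrow> 'k"
  assume D: "hv_circ \<union> range eps1 \<union> range eps2 \<subseteq> W \<and> W \<subseteq> hv_dual \<and>
    formally_linear_on W D \<and> cobracket_formulas D" and u: "u \<in> hv_circ"
  have "D u = hv_bracket_dual u"
  proof (rule formally_linear_on_unique[OF _ formally_linear_on_hv_bracket_dual])
    show "formally_linear_on W D" using D by blast
    show "range eps1 \<union> range eps2 \<subseteq> W \<inter> hv_dual" using D by blast
    show "u \<in> W \<inter> hv_dual \<inter> hv_dual" using D u by blast
    show "D (eps1 m) = hv_bracket_dual (eps1 m)" "D (eps2 m) = hv_bracket_dual (eps2 m)" for m
      using D by (simp_all add: cobracket_formulas_unique[OF _ cobracket_formulas_hv_bracket_dual])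
  qed
  then show "D u = \<Delta> u"
    using u by (simp add: \<Delta>_def hv_cobracket_def)
qed

end
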